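(* Let $q\in\mathbb{C}$ with $0<|q|<1$. For all $a,z\in\mathbb{C}$ with $z\notin\{q^{n}: n=0,-1,-2,\dots\}$, $$(z;q)_{\infty}\,{}_{1}\phi_{1}(a;z;q,-z)=\sum_{n=0}^{\infty}\frac{q^{2n^{2}-n}z^{2n}}{(q^{2};q^{2})_{n}}A_{q}\left(q^{2n-1}az\right).$$ For all $a,b\in\mathbb{C}$ with $b\notin\{q^{n}: n=0,-1,-2,\dots\}$, $$(b;q)_{\infty}\,{}_{1}\phi_{1}(a;b;q,-b)=\sum_{n=0}^{\infty}\frac{q^{n^{2}-n}(-ab)^{n}}{(q;q)_{n}}A_{q^{2}}\left(-q^{2n-1}b^{2}\right).$$ For all $a,b\in\mathbb{C}$, $$\sum_{n=0}^{\infty}\frac{q^{2n^{2}-n}b^{2n}}{(q^{2};q^{2})_{n}}A_{q}\left(q^{2n-1}ab\right)=\sum_{n=0}^{\infty}\frac{q^{n^{2}-n}(-ab)^{n}}{(q;q)_{n}}A_{q^{2}}\left(-q^{2n-1}b^{2}\right).$$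
   Context: Notation: for a base $p$ with $|p|<1$, $(a;p)_\infty=\prod_{k\ge0}(1-ap^k)$ and $(a;p)_n=\prod_{k=0}^{n-1}(1-ap^k)$. The Ramanujan function with base $p$ is $A_p(x)=\sum_{n=0}^\infty \frac{p^{n^2}}{(p;p)_n}(-x)^n$. The basic hypergeometric function is ${}_1\phi_1(a;c;q,x)=\sum_{n=0}^\infty\frac{(a;q)_n}{(q;q)_n(c;q)_n}(-1)^nq^{n(n-1)/2}x^n$. *)

theory Defs
  imports "HOL-Analysis.Analysis"
begin

definition qpoch :: "complex \<Rightarrow> complex \<Rightarrow> nat \<Rightarrow> complex" where
  "qpoch a p n = (\<Prod>k<n. 1 - a * p ^ k)"

(* The library's prodinf is 0 when finitely many factors vanish and the remaining
   product converges, so the value is also correct for a = p powi (- k). *)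
definition qpoch_inf :: "complex \<Rightarrow> complex \<Rightarrow> complex" where
  "qpoch_inf a p = (\<Prod>k. 1 - a * p ^ k)"

definition ramanujan_A :: "complex \<Rightarrow> complex \<Rightarrow> complex" where
  "ramanujan_A p x = (\<Sum>n. p ^ n\<^sup>2 / qpoch p p n * (- x) ^ n)"

(* The arguments a c q x correspond to (a; c; q, x); the factor (-1)^n q^(n(n-1)/2)
   is the one of Gasper and Rahman. *)
definition phi11 :: "complex \<Rightarrow> complex \<Rightarrow> complex \<Rightarrow> complex \<Rightarrow> complex" where
  "phi11 a c q x =
     (\<Sum>n. qpoch a q n / (qpoch q q n * qpoch c q n) * (-1) ^ n * q ^ (n * (n - 1) div 2) * x ^ n)"

end

theory Submission
  imports Defs
begin

text \<open>
All three expressions are rearrangements of one absolutely convergent double series,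
whose \<open>(m, n)\<close> term is
\<open>(- a b)^m q^(m^2 - m) / (q; q)_m\<close> times
\<open>b^(2 n) q^(2 n^2 - n) / (q^2; q^2)_n\<close> times \<open>q^(2 m n)\<close>.

Summed over \<open>m\<close> first, it is the series in \<open>A_q\<close>; summed over \<open>n\<close> first, it is the series in
\<open>A_(q^2)\<close>. This is the third identity, and both computations only compare exponents of \<open>q\<close>,
the cross term \<open>q^(2 m n)\<close> being what the factor \<open>q^(2 n - 1)\<close> in the arguments produces.

The left-hand side \<open>(z; q)_inf 1phi1(a; z; q, - z)\<close> is reduced to the same series in two steps.
Dividing \<open>(z; q)_N\<close> out of the infinite product gives the series with terms
\<open>(a; q)_N / (q; q)_N q^(N choose 2) z^N (z q^N; q)_inf\<close>. Cauchy's finite q-binomial theorem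
expands \<open>(a; q)_N\<close> in powers of \<open>a\<close>; with \<open>N = m + k\<close> and \<open>w = z q^m\<close>, the coefficient of
\<open>(- a)^m\<close> is a monomial times
\<open>sum_k q^(k choose 2) w^k / (q; q)_k (w q^k; q)_inf\<close>
(\<open>qpoch_inf_mult_phi11\<close>). In that sum, Euler's expansion of the infinite product
(\<open>euler_qpoch_inf\<close>) gives \<open>w^N\<close> the coefficient \<open>q^(N choose 2) / (q; q)_N\<close> times the
alternating sum of the Gaussian binomial coefficients of order \<open>N\<close>. By Gauss that alternating
sum vanishes for odd \<open>N\<close> and equals \<open>(q; q^2)_n\<close> for \<open>N = 2 n\<close>, so only the even powers
\<open>q^(2 n^2 - n) w^(2 n) / (q^2; q^2)_n\<close> remain (\<open>sum_shifted_qpoch_inf\<close>).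

The Gaussian factor \<open>q^(n choose 2)\<close> dominates every geometric factor, so each double series is
bounded termwise by a product of two convergent single series and may be summed by rows, columns
or diagonals (\<open>double_series_dominated_by_product\<close>).
\<close>

section \<open>Rearranging double series\<close>

text \<open>
The bound makes the family absolutely summable over pairs, so Fubini applies to the three
partitions of the index set. The diagonal series is used as the common value because it is the
one in which the coefficients of a product of power series appear.
\<close>
lemma double_series_dominated_by_product:
  fixes f :: "nat \<Rightarrow> nat \<Rightarrow> complex" and g h :: "nat \<Rightarrow> real"
  assumes g: "summable g" and h: "summable h"
    and bound: "\<And>i j. norm (f i j) \<le> g i * h j"
    and nonneg: "\<And>i. 0 \<le> g i" "\<And>j. 0 \<le> h j"
  shows "(\<lambda>i. \<Sum>j. f i j) sums (\<Sum>N. \<Sum>i\<le>N. f i (N - i))"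
    and "(\<lambda>j. \<Sum>i. f i j) sums (\<Sum>N. \<Sum>i\<le>N. f i (N - i))"
    and "(\<lambda>N. \<Sum>i\<le>N. f i (N - i)) sums (\<Sum>N. \<Sum>i\<le>N. f i (N - i))"
proof -
  let ?F = "\<lambda>(i, j). f i j"
  have gh: "(\<lambda>(i, j). g i * h j) summable_on UNIV \<times> UNIV"
  proof (rule summable_on_SigmaI)
    have "(h has_sum suminf h) UNIV"
      using h nonneg(2) by (intro sums_nonneg_imp_has_sum) (auto simp: summable_sums)
    then show "((\<lambda>j. (\<lambda>(i, j). g i * h j) (i, j)) has_sum (g i * suminf h)) UNIV" for i
      by (simp add: has_sum_cmult_right)
    have "g summable_on UNIV"
      using g nonneg(1) by (intro summable_nonneg_imp_summable_on) auto
    then show "(\<lambda>i. g i * suminf h) summable_on UNIV"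
      by (rule summable_on_cmult_left)
  qed (use nonneg in auto)
  have F: "?F summable_on UNIV \<times> UNIV"
    by (rule abs_summable_summable, rule Infinite_Sum.abs_summable_on_comparison_test'[OF gh])
       (use bound in auto)
  then obtain S where S: "(?F has_sum S) (UNIV \<times> UNIV)"
    by (auto simp: summable_on_def)
  have row: "((\<lambda>j. f i j) has_sum (\<Sum>j. f i j)) UNIV" for i
  proof (rule norm_summable_imp_has_sum)
    show "summable (\<lambda>j. norm (f i j))"
      by (rule summable_comparison_test'[OF summable_mult[OF h, of "g i"]]) (use bound in auto)
    then show "(\<lambda>j. f i j) sums (\<Sum>j. f i j)"
      by (auto dest: summable_norm_cancel)
  qed
  have col: "((\<lambda>i. f i j) has_sum (\<Sum>i. f i j)) UNIV" for j
  proof (rule norm_summable_imp_has_sum)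
    show "summable (\<lambda>i. norm (f i j))"
      by (rule summable_comparison_test'[OF summable_mult2[OF g, of "h j"]]) (use bound in auto)
    then show "(\<lambda>i. f i j) sums (\<Sum>i. f i j)"
      by (auto dest: summable_norm_cancel)
  qed
  have "((\<lambda>i. \<Sum>j. f i j) has_sum S) UNIV"
    by (rule has_sum_SigmaD[OF S]) (use row in auto)
  then have rows: "(\<lambda>i. \<Sum>j. f i j) sums S"
    by (rule has_sum_imp_sums)
  have S': "((\<lambda>(j, i). f i j) has_sum S) (UNIV \<times> UNIV)"
    using S by (subst has_sum_reindex_bij_witness
        [where i = prod.swap and j = prod.swap and h = ?F and T = "UNIV \<times> UNIV"]) auto
  have "((\<lambda>j. \<Sum>i. f i j) has_sum S) UNIV"
    by (rule has_sum_SigmaD[OF S']) (use col in auto)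
  then have cols: "(\<lambda>j. \<Sum>i. f i j) sums S"
    by (rule has_sum_imp_sums)
  have D: "((\<lambda>(N, i). f i (N - i)) has_sum S) (Sigma UNIV (\<lambda>N. {..N}))"
    using S by (subst has_sum_reindex_bij_witness
        [where i = "\<lambda>(i, j). (i + j, i)" and j = "\<lambda>(N, i). (i, N - i)"
          and h = ?F and T = "UNIV \<times> UNIV"]) auto
  have "((\<lambda>N. \<Sum>i\<le>N. f i (N - i)) has_sum S) UNIV"
    by (rule has_sum_SigmaD[OF D]) auto
  then have diag: "(\<lambda>N. \<Sum>i\<le>N. f i (N - i)) sums S"
    by (rule has_sum_imp_sums)
  then have "S = (\<Sum>N. \<Sum>i\<le>N. f i (N - i))"
    by (simp add: sums_iff)
  with rows cols diag
  show "(\<lambda>i. \<Sum>j. f i j) sums (\<Sum>N. \<Sum>i\<le>N. f i (N - i))"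
    and "(\<lambda>j. \<Sum>i. f i j) sums (\<Sum>N. \<Sum>i\<le>N. f i (N - i))"
    and "(\<lambda>N. \<Sum>i\<le>N. f i (N - i)) sums (\<Sum>N. \<Sum>i\<le>N. f i (N - i))"
    by simp_all
qed

section \<open>Gaussian binomial coefficients\<close>

lemma zero_choose_two [simp]: "0 choose 2 = 0"
  by (simp add: choose_two)

lemma Suc_choose_two: "Suc n choose 2 = n + (n choose 2)"
  by (simp add: numeral_2_eq_2)

lemma add_choose_two: "(m + k) choose 2 = (m choose 2) + (k choose 2) + m * k"
  by (induction k) (simp_all add: Suc_choose_two numeral_2_eq_2[symmetric])

lemma double_choose_two: "(2 * n) choose 2 = 2 * n\<^sup>2 - n"
  by (cases n) (simp_all add: choose_two power2_eq_square algebra_simps)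

lemma square_minus_self: "n\<^sup>2 - n = 2 * (n choose 2)"
proof -
  have "n\<^sup>2 = 2 * (n choose 2) + n"
    by (induction n) (simp_all add: Suc_choose_two power2_eq_square)
  then show ?thesis
    by simp
qed

lemma qpoch_0 [simp]: "qpoch a q 0 = 1"
  by (simp add: qpoch_def)

lemma qpoch_Suc: "qpoch a q (Suc n) = qpoch a q n * (1 - a * q ^ n)"
  by (simp add: qpoch_def)

lemma qpoch_Suc_shift: "qpoch a q (Suc n) = (1 - a) * qpoch (a * q) q n"
  by (simp add: qpoch_def prod.lessThan_Suc_shift mult.assoc del: prod.lessThan_Suc)

lemma power_norm_less_1_neq_1:
  fixes q :: complex
  assumes "norm q < 1"
  shows "q ^ Suc n \<noteq> 1"
proof
  assume "q ^ Suc n = 1"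
  then have "norm q ^ Suc n = 1"
    by (metis norm_one norm_power)
  with power_Suc_less_one[of "norm q" n] assms show False
    by (cases "q = 0") auto
qed

lemma qpoch_self_nonzero:
  assumes "norm q < 1"
  shows "qpoch q q n \<noteq> 0"
  using power_norm_less_1_neq_1[OF assms] by (auto simp: qpoch_def)

text \<open>
The Pascal recursion keeps the coefficients polynomial in \<open>q\<close> and zero above the diagonal, so that
sums over \<open>k \<le> n\<close> may be shifted without boundary terms; the quotient of q-shifted factorials
is recovered in \<open>qbinom_qpoch\<close>.
\<close>
fun qbinom :: "complex \<Rightarrow> nat \<Rightarrow> nat \<Rightarrow> complex" where
  "qbinom q n 0 = 1"
| "qbinom q 0 (Suc k) = 0"
| "qbinom q (Suc n) (Suc k) = q ^ Suc k * qbinom q n (Suc k) + qbinom q n k"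

lemma qbinom_eq_0: "n < k \<Longrightarrow> qbinom q n k = 0"
  by (induction q n k rule: qbinom.induct) auto

lemma qbinom_self [simp]: "qbinom q n n = 1"
  by (induction n) (auto simp: qbinom_eq_0)

text \<open>
Both Pascal neighbours reduce to the same factorial \<open>(q; q)_(k + m - 1)\<close>, and their weights
add up to the missing factor:
\<open>q^k (1 - q^m) + (1 - q^k) = 1 - q^(k + m)\<close>.
\<close>
lemma qbinom_qpoch: "qbinom q (k + m) k * (qpoch q q k * qpoch q q m) = qpoch q q (k + m)"
proof (induction "k + m" arbitrary: k m)
  case 0
  then show ?case by simp
next
  case (Suc n)
  show ?case
  proof (cases "k = 0 \<or> m = 0")
    case True
    then show ?thesis by auto
  next
    case False
    then obtain k' m' where km: "k = Suc k'" "m = Suc m'"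
      by (metis not0_implies_Suc)
    have n: "n = k' + Suc m'" "n = Suc k' + m'"
      using Suc.hyps(2) km by auto
    let ?P = "qpoch q q n"
    have 1: "qbinom q n (Suc k') * (qpoch q q (Suc k') * qpoch q q m') = ?P"
      using Suc.hyps(1)[OF n(2)] n(2) by simp
    have 2: "qbinom q n k' * (qpoch q q k' * qpoch q q (Suc m')) = ?P"
      using Suc.hyps(1)[OF n(1)] n(1) by simp
    have "qbinom q (k + m) k * (qpoch q q k * qpoch q q m)
        = q ^ Suc k' * (1 - q ^ Suc m') * (qbinom q n (Suc k') * (qpoch q q (Suc k') * qpoch q q m'))
          + (1 - q ^ Suc k') * (qbinom q n k' * (qpoch q q k' * qpoch q q (Suc m')))"
      using km n by (simp add: qpoch_Suc algebra_simps)
    also have "\<dots> = ?P * (1 - q ^ Suc k' * q ^ Suc m')"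
      unfolding 1 2 by (simp add: algebra_simps)
    also have "q ^ Suc k' * q ^ Suc m' = q * q ^ n"
      using n by (simp add: power_add)
    finally show ?thesis
      by (simp add: qpoch_Suc Suc.hyps(2)[symmetric])
  qed
qed

lemma qbinom_eq_qpoch_quotient:
  assumes "norm q < 1" "k \<le> n"
  shows "qbinom q n k = qpoch q q n / (qpoch q q k * qpoch q q (n - k))"
  using qbinom_qpoch[of q k "n - k"] assms qpoch_self_nonzero[OF assms(1)]
  by (simp add: field_simps)

lemma qbinom_absorption:
  assumes "norm q < 1" "k \<le> n"
  shows "(1 - q ^ Suc k) * qbinom q (Suc n) (Suc k) = (1 - q ^ Suc n) * qbinom q n k"
proof -
  have "1 - q ^ Suc k \<noteq> 0"
    using power_norm_less_1_neq_1[OF assms(1)] by (simp del: power_Suc)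
  then show ?thesis
    using assms qpoch_self_nonzero[OF assms(1)]
    by (simp add: qbinom_eq_qpoch_quotient qpoch_Suc field_simps del: qbinom.simps)
qed

text \<open>
By the Pascal recursion the right-hand side \<open>P_N(a)\<close> satisfies
\<open>P_(N + 1)(a) = (1 - a) P_N(a q)\<close>, which is also how \<open>(a; q)_N\<close> grows when its first factor is
split off.
\<close>
theorem cauchy_qbinomial:
  "qpoch a q N = (\<Sum>m\<le>N. qbinom q N m * q ^ (m choose 2) * (- a) ^ m)"
proof (induction N arbitrary: a)
  case 0
  then show ?case by simp
next
  case (Suc N)
  let ?t = "\<lambda>m. qbinom q N m * q ^ (m choose 2) * (- (a * q)) ^ m"
  have "(\<Sum>m\<le>Suc N. qbinom q (Suc N) m * q ^ (m choose 2) * (- a) ^ m)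
      = 1 + (\<Sum>m\<le>N. qbinom q (Suc N) (Suc m) * q ^ (Suc m choose 2) * (- a) ^ Suc m)"
    by (subst sum.atMost_Suc_shift) simp
  also have "(\<Sum>m\<le>N. qbinom q (Suc N) (Suc m) * q ^ (Suc m choose 2) * (- a) ^ Suc m)
      = (\<Sum>m\<le>N. ?t (Suc m) + (- a) * ?t m)"
    by (intro sum.cong refl)
       (simp add: Suc_choose_two power_add power_mult_distrib power_minus[of a]
          power_minus[of "a * q"] algebra_simps)
  also have "1 + \<dots> = (\<Sum>m\<le>Suc N. ?t m) - a * (\<Sum>m\<le>N. ?t m)"
    by (subst sum.atMost_Suc_shift) (simp add: sum.distrib sum_distrib_left sum_negf sum_subtractf del: power_Suc)
  also have "(\<Sum>m\<le>Suc N. ?t m) = (\<Sum>m\<le>N. ?t m)"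
    by (simp add: qbinom_eq_0)
  also have "(\<Sum>m\<le>N. ?t m) - a * (\<Sum>m\<le>N. ?t m) = qpoch a q (Suc N)"
    unfolding Suc.IH[symmetric] by (simp add: qpoch_Suc_shift left_diff_distrib)
  finally show ?case ..
qed

text \<open>
The alternating sum of Gaussian binomial coefficients is the value at \<open>- 1\<close> of the Rogers-Szego
polynomial. The variable \<open>x\<close> is kept because the recursion in \<open>n\<close> dilates it by \<open>q\<close>; combining
that recursion with the q-difference equation cancels the dilated term.
\<close>
definition rogers_szego :: "complex \<Rightarrow> nat \<Rightarrow> complex \<Rightarrow> complex" where
  "rogers_szego q n x = (\<Sum>j\<le>n. qbinom q n j * x ^ j)"

lemma rogers_szego_Suc:
  "rogers_szego q (Suc n) x = rogers_szego q n (x * q) + x * rogers_szego q n x"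
proof -
  have "rogers_szego q (Suc n) x = 1 + (\<Sum>j\<le>n. qbinom q (Suc n) (Suc j) * x ^ Suc j)"
    unfolding rogers_szego_def by (subst sum.atMost_Suc_shift) simp
  also have "\<dots> = 1 + (\<Sum>j\<le>n. qbinom q n (Suc j) * (x * q) ^ Suc j) + x * rogers_szego q n x"
    by (simp add: rogers_szego_def sum_distrib_left sum.distrib[symmetric] power_mult_distrib
        algebra_simps)
  also have "1 + (\<Sum>j\<le>n. qbinom q n (Suc j) * (x * q) ^ Suc j)
      = (\<Sum>j\<le>Suc n. qbinom q n j * (x * q) ^ j)"
    by (subst sum.atMost_Suc_shift) simp
  also have "\<dots> = rogers_szego q n (x * q)"
    by (simp add: rogers_szego_def qbinom_eq_0)
  finally show ?thesis .
qed

lemma rogers_szego_qdiff: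
  assumes "norm q < 1"
  shows "rogers_szego q (Suc n) x - rogers_szego q (Suc n) (x * q)
      = x * (1 - q ^ Suc n) * rogers_szego q n x"
proof -
  have "rogers_szego q (Suc n) x - rogers_szego q (Suc n) (x * q)
      = (\<Sum>j\<le>Suc n. (1 - q ^ j) * qbinom q (Suc n) j * x ^ j)"
    by (simp add: rogers_szego_def sum_subtractf[symmetric] power_mult_distrib algebra_simps
        del: sum.atMost_Suc)
  also have "\<dots> = (\<Sum>j\<le>n. (1 - q ^ Suc j) * qbinom q (Suc n) (Suc j) * x ^ Suc j)"
    by (subst sum.atMost_Suc_shift) simp
  also have "\<dots> = (\<Sum>j\<le>n. x * (1 - q ^ Suc n) * (qbinom q n j * x ^ j))"
    by (intro sum.cong refl) (simp add: qbinom_absorption[OF assms] del: qbinom.simps power_Suc, simp)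
  finally show ?thesis
    by (simp add: rogers_szego_def sum_distrib_left)
qed

text \<open>
At \<open>x = - 1\<close> the middle term \<open>(1 + x) h_(n + 1)(x)\<close> of the three-term recurrence disappears, so
that odd and even orders decouple: the odd ones inherit the value \<open>0\<close> from order \<open>1\<close>, the even
ones collect the factors \<open>1 - q^(2 k + 1)\<close>.
\<close>
lemma rogers_szego_minus_one_Suc_Suc:
  assumes "norm q < 1"
  shows "rogers_szego q (Suc (Suc n)) (-1) = (1 - q ^ Suc n) * rogers_szego q n (-1)"
proof -
  have "rogers_szego q (Suc (Suc n)) (-1)
      = - (rogers_szego q (Suc n) (-1) - rogers_szego q (Suc n) (-1 * q))"
    by (simp add: rogers_szego_Suc[of q "Suc n" "-1"])
  then show ?thesis
    unfolding rogers_szego_qdiff[OF assms] by (simp add: left_diff_distrib)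
qed

lemma rogers_szego_minus_one_odd:
  assumes "norm q < 1"
  shows "rogers_szego q (Suc (2 * n)) (-1) = 0"
proof (induction n)
  case 0
  show ?case by (simp add: rogers_szego_def)
next
  case (Suc n)
  then show ?case
    using rogers_szego_minus_one_Suc_Suc[OF assms, of "Suc (2 * n)"] by simp
qed

lemma rogers_szego_minus_one_even:
  assumes "norm q < 1"
  shows "rogers_szego q (2 * n) (-1) * qpoch (q\<^sup>2) (q\<^sup>2) n = qpoch q q (2 * n)"
proof (induction n)
  case 0
  show ?case by (simp add: rogers_szego_def)
next
  case (Suc n)
  have "q\<^sup>2 * (q\<^sup>2) ^ n = q * q ^ Suc (2 * n)"
    by (simp add: power_mult power2_eq_square)
  then have "rogers_szego q (2 * Suc n) (-1) * qpoch (q\<^sup>2) (q\<^sup>2) (Suc n)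
      = (1 - q ^ Suc (2 * n)) * (1 - q * q ^ Suc (2 * n))
        * (rogers_szego q (2 * n) (-1) * qpoch (q\<^sup>2) (q\<^sup>2) n)"
    using rogers_szego_minus_one_Suc_Suc[OF assms, of "2 * n"]
    by (simp only: qpoch_Suc mult_Suc_right add_2_eq_Suc) (simp only: mult_ac)
  also have "\<dots> = qpoch q q (2 * Suc n)"
    unfolding Suc.IH by (simp add: qpoch_Suc mult_ac)
  finally show ?case .
qed

section \<open>Euler's expansion of the infinite q-shifted factorial\<close>

definition euler_coeff :: "complex \<Rightarrow> nat \<Rightarrow> complex" where
  "euler_coeff q n = q ^ (n choose 2) / qpoch q q n"

lemma euler_coeff_0 [simp]: "euler_coeff q 0 = 1"
  by (simp add: euler_coeff_def)

lemma euler_coeff_Suc: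
  assumes "norm q < 1"
  shows "euler_coeff q (Suc n) * (1 - q ^ Suc n) = q ^ n * euler_coeff q n"
  using qpoch_self_nonzero[OF assms] power_norm_less_1_neq_1[OF assms, of n]
  by (simp add: euler_coeff_def Suc_choose_two power_add qpoch_Suc field_simps)

text \<open>
The ratio of consecutive terms is \<open>q^n x / (1 - q^(n + 1))\<close>, which tends to \<open>0\<close>; hence the radius
of convergence is infinite.
\<close>
lemma summable_norm_euler:
  assumes q: "norm q < 1"
  shows "summable (\<lambda>n. norm (euler_coeff q n * x ^ n))"
proof -
  have "(\<lambda>n. q ^ n) \<longlonglongrightarrow> 0"
    using q by (rule LIMSEQ_power_zero)
  then have "(\<lambda>n. q ^ n * x / (1 - q * q ^ n)) \<longlonglongrightarrow> 0 * x / (1 - q * 0)"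
    by (intro tendsto_divide tendsto_diff tendsto_mult tendsto_const) auto
  then have "\<forall>\<^sub>F n in sequentially. norm (q ^ n * x / (1 - q * q ^ n)) < 1/2"
    using order_tendstoD(2)[OF tendsto_norm, of _ "0::complex" sequentially "1/2"] by simp
  then obtain N where N: "\<And>n. n \<ge> N \<Longrightarrow> norm (q ^ n * x / (1 - q * q ^ n)) < 1/2"
    by (auto simp: eventually_sequentially)
  show ?thesis
  proof (rule summable_ratio_test[where c = "1/2" and N = N])
    fix n assume "n \<ge> N"
    have "euler_coeff q (Suc n) = q ^ n * euler_coeff q n / (1 - q ^ Suc n)"
      using euler_coeff_Suc[OF q, of n] power_norm_less_1_neq_1[OF q, of n]
      by (simp add: field_simps)
    then have "euler_coeff q (Suc n) * x ^ Suc n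
        = (q ^ n * x / (1 - q * q ^ n)) * (euler_coeff q n * x ^ n)"
      by simp
    then have "norm (euler_coeff q (Suc n) * x ^ Suc n)
        = norm (q ^ n * x / (1 - q * q ^ n)) * norm (euler_coeff q n * x ^ n)"
      by (simp only: norm_mult)
    also have "\<dots> \<le> 1 / 2 * norm (euler_coeff q n * x ^ n)"
      using N[OF \<open>n \<ge> N\<close>] by (intro mult_right_mono) auto
    finally show "norm (norm (euler_coeff q (Suc n) * x ^ Suc n))
        \<le> 1 / 2 * norm (norm (euler_coeff q n * x ^ n))"
      by simp
  qed auto
qed

lemma summable_euler:
  assumes "norm q < 1"
  shows "summable (\<lambda>n. euler_coeff q n * x ^ n)"
  using summable_norm_euler[OF assms] by (rule summable_norm_cancel)

lemma qpoch_tendsto_qpoch_inf: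
  assumes q: "norm q < 1"
  shows "qpoch x q \<longlonglongrightarrow> qpoch_inf x q"
proof -
  have "summable (\<lambda>k. norm ((1 - x * q ^ k) - 1))"
    using q by (simp add: norm_mult norm_power summable_mult)
  then have "convergent_prod (\<lambda>k. 1 - x * q ^ k)"
    by (intro abs_convergent_prod_imp_convergent_prod)
       (simp add: abs_convergent_prod_conv_summable)
  then have "(\<lambda>n. \<Prod>k\<le>n. 1 - x * q ^ k) \<longlonglongrightarrow> qpoch_inf x q"
    unfolding qpoch_inf_def by (rule convergent_prod_LIMSEQ)
  then have "(\<lambda>n. qpoch x q (Suc n)) \<longlonglongrightarrow> qpoch_inf x q"
    by (simp add: qpoch_def lessThan_Suc_atMost del: prod.lessThan_Suc)
  then show ?thesis
    by (rule LIMSEQ_imp_Suc)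
qed

lemma qpoch_inf_split:
  assumes "norm q < 1"
  shows "qpoch_inf x q = qpoch x q n * qpoch_inf (x * q ^ n) q"
proof -
  have "(\<Prod>k<n + m. 1 - x * q ^ k) = (\<Prod>k<n. 1 - x * q ^ k) * (\<Prod>k<m. 1 - x * q ^ (n + k))" for m
    by (induction m) (simp_all add: mult.assoc)
  then have "qpoch x q (m + n) = qpoch x q n * qpoch (x * q ^ n) q m" for m
    by (simp add: qpoch_def add.commute[of m] power_add mult.assoc)
  then have "(\<lambda>m. qpoch x q (m + n)) \<longlonglongrightarrow> qpoch x q n * qpoch_inf (x * q ^ n) q"
    by (simp add: tendsto_mult_left qpoch_tendsto_qpoch_inf[OF assms])
  moreover have "(\<lambda>m. qpoch x q (m + n)) \<longlonglongrightarrow> qpoch_inf x q"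
    using qpoch_tendsto_qpoch_inf[OF assms] by (rule LIMSEQ_ignore_initial_segment)
  ultimately show ?thesis
    by (metis LIMSEQ_unique)
qed

text \<open>
Comparing coefficients, the power series \<open>E\<close> satisfies \<open>E(y) = (1 + y) E(y q)\<close>. Iterating
peels off \<open>(x; q)_n\<close> from \<open>E(- x)\<close>, and the remaining factor \<open>E(- x q^n)\<close> tends to
\<open>E(0) = 1\<close> by continuity.
\<close>
theorem euler_qpoch_inf:
  assumes q: "norm q < 1"
  shows "qpoch_inf x q = (\<Sum>n. euler_coeff q n * (- x) ^ n)"
proof -
  define E where "E x = (\<Sum>n. euler_coeff q n * x ^ n)" for x
  have E_functional: "E y = (1 + y) * E (y * q)" for y
  proof -
    note summable = summable_euler[OF q]
    have "E y - E (y * q) = (\<Sum>n. euler_coeff q n * (1 - q ^ n) * y ^ n)"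
      unfolding E_def suminf_diff[OF summable summable]
      by (simp add: algebra_simps power_mult_distrib)
    also have "\<dots> = (\<Sum>n. euler_coeff q (Suc n) * (1 - q ^ Suc n) * y ^ Suc n)"
    proof -
      have "summable (\<lambda>n. euler_coeff q n * y ^ n - euler_coeff q n * (y * q) ^ n)"
        by (intro summable_diff summable)
      then have "summable (\<lambda>n. euler_coeff q n * (1 - q ^ n) * y ^ n)"
        by (simp add: algebra_simps power_mult_distrib)
      from suminf_split_head[OF this] show ?thesis
        by simp
    qed
    also have "\<dots> = (\<Sum>n. y * (euler_coeff q n * (y * q) ^ n))"
      by (simp only: euler_coeff_Suc[OF q]) (simp add: algebra_simps power_mult_distrib)
    also have "\<dots> = y * E (y * q)"
      unfolding E_def by (rule suminf_mult[OF summable])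
    finally show ?thesis
      by (simp add: algebra_simps)
  qed
  have iterate: "E (- x) = qpoch x q n * E (- x * q ^ n)" for n
  proof (induction n)
    case 0
    show ?case by simp
  next
    case (Suc n)
    have "E (- x * q ^ n) = (1 - x * q ^ n) * E (- x * q ^ Suc n)"
      using E_functional[of "- x * q ^ n"] by (simp add: mult_ac)
    then show ?case
      using Suc.IH by (simp add: qpoch_Suc mult_ac)
  qed
  have "isCont E 0"
    unfolding E_def by (rule isCont_powser[where K = 1]) (use summable_euler[OF q, of 1] in auto)
  moreover have "(\<lambda>n. - x * q ^ n) \<longlonglongrightarrow> 0"
    using LIMSEQ_power_zero[OF q] by (rule tendsto_mult_right_zero)
  ultimately have "(\<lambda>n. E (- x * q ^ n)) \<longlonglongrightarrow> E 0"
    by (rule isCont_tendsto_compose)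
  moreover have "E 0 = 1"
    unfolding E_def by simp
  ultimately have "(\<lambda>n. qpoch x q n * E (- x * q ^ n)) \<longlonglongrightarrow> qpoch_inf x q * 1"
    by (metis tendsto_mult qpoch_tendsto_qpoch_inf[OF q])
  then have "E (- x) = qpoch_inf x q"
    unfolding iterate[symmetric] by (simp add: LIMSEQ_const_iff)
  then show ?thesis
    by (simp add: E_def)
qed

text \<open>
This gives a bound on \<open>(z q^n; q)_inf\<close> uniform in \<open>n\<close>, needed for the domination of the double
series.
\<close>
lemma norm_qpoch_inf_le:
  assumes q: "norm q < 1" and "norm x \<le> norm y"
  shows "norm (qpoch_inf x q) \<le> (\<Sum>n. norm (euler_coeff q n * y ^ n))"
proof -
  have "norm (qpoch_inf x q) \<le> (\<Sum>n. norm (euler_coeff q n * (- x) ^ n))"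
    unfolding euler_qpoch_inf[OF q] by (rule summable_norm[OF summable_norm_euler[OF q]])
  also have "\<dots> \<le> (\<Sum>n. norm (euler_coeff q n * y ^ n))"
    using assms(2) by (intro suminf_le summable_norm_euler[OF q])
      (auto simp: norm_mult norm_power intro!: mult_left_mono power_mono)
  finally show ?thesis .
qed

section \<open>The common double series\<close>

text \<open>
This is \<open>A_(q^2)(- w^2 / q)\<close> for \<open>q \<noteq> 0\<close>, written without the division by \<open>q\<close> and with
the exponent \<open>2 n^2 - n\<close> as \<open>2 n choose 2\<close>, the form in which it arises from the expansion.
\<close>
definition even_series :: "complex \<Rightarrow> complex \<Rightarrow> complex" where
  "even_series q w = (\<Sum>n. q ^ ((2 * n) choose 2) * w ^ (2 * n) / qpoch (q\<^sup>2) (q\<^sup>2) n)"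

lemma summable_norm_even_series:
  assumes q: "norm q < 1"
  shows "summable (\<lambda>n. norm (q ^ ((2 * n) choose 2) * w ^ (2 * n) / qpoch (q\<^sup>2) (q\<^sup>2) n))"
proof -
  have q2: "norm (q\<^sup>2) < 1"
    using q by (simp add: norm_power power_less_one_iff)
  have "norm (q ^ ((2 * n) choose 2) * w ^ (2 * n) / qpoch (q\<^sup>2) (q\<^sup>2) n)
      \<le> norm (euler_coeff (q\<^sup>2) n * (w\<^sup>2) ^ n)" for n
  proof -
    have "norm q ^ ((2 * n) choose 2) \<le> norm q ^ (2 * (n choose 2))"
      using q by (intro power_decreasing) (auto simp: mult_2 add_choose_two)
    then show ?thesis
      by (auto simp: euler_coeff_def norm_mult norm_divide norm_power power_mult
          intro!: divide_right_mono mult_right_mono)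
  qed
  then show ?thesis
    by (intro summable_comparison_test'[OF summable_norm_euler[OF q2]]) auto
qed

text \<open>
After Euler's expansion of each infinite product, the exponents
\<open>(j choose 2) + (k choose 2) + j k\<close> on the diagonal \<open>j + k = N\<close> all equal \<open>N choose 2\<close>. What is
left of the diagonal is the alternating sum of Gaussian binomial coefficients.
\<close>
theorem sum_shifted_qpoch_inf:
  assumes q: "norm q < 1"
  shows "(\<lambda>k. euler_coeff q k * w ^ k * qpoch_inf (w * q ^ k) q) sums even_series q w"
proof -
  define f where
    "f j k = euler_coeff q k * w ^ k * (euler_coeff q j * (- (w * q ^ k)) ^ j)" for j k
  define g where "g k = norm (euler_coeff q k * w ^ k)" for k
  have bound: "norm (f j k) \<le> g j * g k" for j k
  proof -
    have "norm (- (w * q ^ k)) ^ j \<le> norm w ^ j"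
      using q by (intro power_mono) (auto simp: norm_mult norm_power power_le_one mult_left_le)
    then have "norm (euler_coeff q j * (- (w * q ^ k)) ^ j) \<le> g j"
      unfolding g_def norm_mult norm_power by (intro mult_left_mono) auto
    then have "g k * norm (euler_coeff q j * (- (w * q ^ k)) ^ j) \<le> g k * g j"
      by (intro mult_left_mono) (auto simp: g_def)
    then show ?thesis
      by (simp add: f_def g_def norm_mult mult_ac)
  qed
  have g: "summable g" "\<And>k. 0 \<le> g k"
    unfolding g_def using summable_norm_euler[OF q] by auto
  note D = double_series_dominated_by_product[OF g(1) g(1) bound g(2) g(2)]
  define c where
    "c N = q ^ (N choose 2) / qpoch q q N * w ^ N * rogers_szego q N (-1)" for N
  have diag: "(\<Sum>j\<le>N. f j (N - j)) = c N" for N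
  proof -
    have "f j (N - j) = q ^ (N choose 2) / qpoch q q N * w ^ N * (qbinom q N j * (-1) ^ j)"
      if "j \<le> N" for j
    proof -
      define k where "k = N - j"
      have N: "N = j + k"
        using that by (simp add: k_def)
      have "(- (w * q ^ k)) ^ j = (-1) ^ j * w ^ j * q ^ (j * k)"
        by (simp add: power_minus[of "w * q ^ k"] power_mult_distrib power_mult[symmetric] mult.commute)
      then show ?thesis
        unfolding f_def k_def[symmetric]
        using qpoch_self_nonzero[OF q] qbinom_eq_qpoch_quotient[OF q that]
        by (simp add: N euler_coeff_def add_choose_two power_add mult_ac)
    qed
    then show ?thesis
      by (simp add: c_def rogers_szego_def sum_distrib_left)
  qed
  have "c sums (\<Sum>N. c N)"
    using D(3) unfolding diag .
  then have "(\<lambda>n. c (2 * n)) sums (\<Sum>N. c N)"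
  proof (subst sums_mono_reindex)
    show "strict_mono ((*) (2::nat))"
      by (auto intro: strict_monoI)
    fix N :: nat
    assume "N \<notin> range ((*) 2)"
    then obtain n where "N = Suc (2 * n)"
      by (metis evenE oddE Suc_eq_plus1 rangeI)
    then show "c N = 0"
      by (simp add: c_def rogers_szego_minus_one_odd[OF q])
  qed
  moreover have "c (2 * n) = q ^ ((2 * n) choose 2) * w ^ (2 * n) / qpoch (q\<^sup>2) (q\<^sup>2) n" for n
  proof -
    have "qpoch (q\<^sup>2) (q\<^sup>2) n \<noteq> 0"
      using q by (intro qpoch_self_nonzero) (simp add: norm_power power_less_one_iff)
    then have "rogers_szego q (2 * n) (-1) = qpoch q q (2 * n) / qpoch (q\<^sup>2) (q\<^sup>2) n"
      using rogers_szego_minus_one_even[OF q, of n] by (simp add: field_simps)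
    then show ?thesis
      using qpoch_self_nonzero[OF q] by (simp add: c_def)
  qed
  ultimately have "even_series q w = (\<Sum>N. c N)"
    by (simp add: even_series_def sums_iff)
  moreover have "(\<Sum>j. f j k) = euler_coeff q k * w ^ k * qpoch_inf (w * q ^ k) q" for k
    unfolding f_def euler_qpoch_inf[OF q] by (rule suminf_mult[OF summable_euler[OF q]])
  ultimately show ?thesis
    using D(2) unfolding diag by simp
qed

text \<open>
The part \<open>q^(m^2 - m) (- x)^m / (q; q)_m\<close> of the double series that depends on \<open>m\<close> alone. One
factor \<open>q^(m choose 2)\<close> belongs to Euler's coefficient, the other comes from Cauchy's theorem.
\<close>
definition outer_coeff :: "complex \<Rightarrow> complex \<Rightarrow> nat \<Rightarrow> complex" where
  "outer_coeff q x m = euler_coeff q m * q ^ (m choose 2) * (- x) ^ m"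

lemma norm_outer_coeff_le:
  assumes "norm q < 1"
  shows "norm (outer_coeff q x m) \<le> norm (euler_coeff q m * x ^ m)"
  using assms by (auto simp: outer_coeff_def norm_mult norm_power power_le_one
      intro!: mult_right_mono mult_left_le)

text \<open>
The \<open>N\<close>-th term of the left-hand side is the \<open>N\<close>-th diagonal of the family \<open>v\<close> below, by
\<open>(z; q)_inf = (z; q)_N (z q^N; q)_inf\<close> and Cauchy's theorem for \<open>(a; q)_N\<close>. The rows of \<open>v\<close> are
evaluated by \<open>sum_shifted_qpoch_inf\<close> at \<open>w = z q^m\<close>.
\<close>
theorem qpoch_inf_mult_phi11:
  assumes q: "norm q < 1" and z: "\<And>n. qpoch z q n \<noteq> 0"
  shows "qpoch_inf z q * phi11 a z q (- z)
      = (\<Sum>m. outer_coeff q (a * z) m * even_series q (z * q ^ m))"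
proof -
  define K where "K = (\<Sum>n. norm (euler_coeff q n * z ^ n))"
  define v where "v m k = outer_coeff q (a * z) m *
      (euler_coeff q k * (z * q ^ m) ^ k * qpoch_inf (z * q ^ m * q ^ k) q)" for m k
  define g where "g m = norm (euler_coeff q m * (a * z) ^ m)" for m
  define h where "h k = norm (euler_coeff q k * z ^ k) * K" for k
  have K: "norm (qpoch_inf (z * q ^ m * q ^ k) q) \<le> K" for m k
    unfolding K_def using q
    by (intro norm_qpoch_inf_le)
       (auto simp: norm_mult norm_power power_le_one mult.assoc intro!: mult_left_le mult_le_one)
  have "0 \<le> K"
    using K[of 0 0] norm_ge_zero order_trans by blast
  have bound: "norm (v m k) \<le> g m * h k" for m k
  proof -
    have "norm (z * q ^ m) ^ k \<le> norm z ^ k"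
      using q by (intro power_mono) (auto simp: norm_mult norm_power power_le_one mult_left_le)
    then have "norm (euler_coeff q k * (z * q ^ m) ^ k) \<le> norm (euler_coeff q k * z ^ k)"
      unfolding norm_mult[of "euler_coeff q k"] norm_power[of _ k] by (intro mult_left_mono) auto
    then show ?thesis
      unfolding v_def g_def h_def norm_mult[of "outer_coeff q (a * z) m"]
        norm_mult[of _ "qpoch_inf (z * q ^ m * q ^ k) q"]
      using norm_outer_coeff_le[OF q] K \<open>0 \<le> K\<close> by (intro mult_mono) auto
  qed
  have g: "summable g" "\<And>m. 0 \<le> g m"
    unfolding g_def using summable_norm_euler[OF q] by auto
  have h: "summable h" "\<And>k. 0 \<le> h k"
    unfolding h_def using summable_norm_euler[OF q] \<open>0 \<le> K\<close> by (auto intro: summable_mult2)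
  note D = double_series_dominated_by_product[OF g(1) h(1) bound g(2) h(2)]
  define t where "t N = qpoch a q N / (qpoch q q N * qpoch z q N) * (-1) ^ N
      * q ^ (N * (N - 1) div 2) * (- z) ^ N" for N
  have diag: "(\<Sum>m\<le>N. v m (N - m)) = qpoch_inf z q * t N" for N
  proof -
    have "v m (N - m) = qbinom q N m * q ^ (m choose 2) * (- a) ^ m *
        (q ^ (N choose 2) * z ^ N / qpoch q q N * qpoch_inf (z * q ^ N) q)"
      if "m \<le> N" for m
    proof -
      define k where "k = N - m"
      have N: "N = m + k"
        using that by (simp add: k_def)
      have "(z * q ^ m) ^ k = z ^ k * q ^ (m * k)"
        by (simp add: power_mult_distrib power_mult)
      moreover have "(- (a * z)) ^ m = (- a) ^ m * z ^ m"
        by (metis minus_mult_left power_mult_distrib)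
      ultimately show ?thesis
        unfolding v_def k_def[symmetric]
        using qpoch_self_nonzero[OF q] qbinom_eq_qpoch_quotient[OF q that]
        by (simp add: N outer_coeff_def euler_coeff_def add_choose_two power_add mult_ac)
    qed
    then have "(\<Sum>m\<le>N. v m (N - m)) = qpoch a q N *
        (q ^ (N choose 2) * z ^ N / qpoch q q N * qpoch_inf (z * q ^ N) q)"
      unfolding cauchy_qbinomial[of a q N] sum_distrib_right by (intro sum.cong) auto
    also have "\<dots> = qpoch_inf z q * t N"
      using z[of N] by (simp add: t_def qpoch_inf_split[OF q, of z N] choose_two power_minus[of z])
    finally show ?thesis .
  qed
  have "(\<lambda>N. qpoch_inf z q * t N) sums (\<Sum>N. qpoch_inf z q * t N)"
    using D(3) unfolding diag .
  then have "summable (\<lambda>N. qpoch_inf z q * t N)"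
    by (rule sums_summable)
  \<comment> \<open>The constant can be pulled out of the sum if \<open>t\<close> is summable; if the constant is zero, both sides vanish.\<close>
  then have "qpoch_inf z q = 0 \<or> summable t"
    by (simp add: summable_cmult_iff)
  then have "qpoch_inf z q * suminf t = (\<Sum>N. qpoch_inf z q * t N)"
    by (auto simp: suminf_mult)
  then have "qpoch_inf z q * phi11 a z q (- z) = (\<Sum>N. qpoch_inf z q * t N)"
    by (simp only: phi11_def t_def[abs_def])
  moreover have "(\<Sum>N. qpoch_inf z q * t N) = (\<Sum>m. \<Sum>k. v m k)"
    using D(1) unfolding diag by (simp add: sums_iff)
  moreover have "(\<Sum>k. v m k) = outer_coeff q (a * z) m * even_series q (z * q ^ m)" for m
    using sums_mult[OF sum_shifted_qpoch_inf[OF q, of "z * q ^ m"], of "outer_coeff q (a * z) m"]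
    by (simp add: v_def sums_iff)
  ultimately show ?thesis
    by simp
qed

lemma swap_outer_coeff_even_series:
  assumes q: "norm q < 1"
  shows "(\<Sum>m. outer_coeff q x m * even_series q (b * q ^ m))
      = (\<Sum>n. q ^ ((2 * n) choose 2) * b ^ (2 * n) / qpoch (q\<^sup>2) (q\<^sup>2) n
            * (\<Sum>m. outer_coeff q x m * q ^ (2 * n * m)))"
proof -
  define e where "e w n = q ^ ((2 * n) choose 2) * w ^ (2 * n) / qpoch (q\<^sup>2) (q\<^sup>2) n" for w n
  define f where "f m n = outer_coeff q x m * e (b * q ^ m) n" for m n
  have f_alt: "f m n = e b n * (outer_coeff q x m * q ^ (2 * n * m))" for m n
    by (simp add: f_def e_def power_mult_distrib power_mult[symmetric] mult_ac)
  define g where "g m = norm (euler_coeff q m * x ^ m)" for m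
  define h where "h n = norm (e b n)" for n
  have g: "summable g" "\<And>m. 0 \<le> g m"
    unfolding g_def using summable_norm_euler[OF q] by auto
  have h: "summable h" "\<And>k. 0 \<le> h k"
    unfolding h_def e_def using summable_norm_even_series[OF q] by auto
  have le_g: "norm (outer_coeff q x m * q ^ (2 * n * m)) \<le> g m" for m n
  proof -
    have "norm (outer_coeff q x m * q ^ (2 * n * m)) \<le> norm (outer_coeff q x m)"
      using q by (simp add: norm_mult norm_power power_le_one mult_left_le)
    then show ?thesis
      using norm_outer_coeff_le[OF q, of x m] by (simp add: g_def)
  qed
  have bound: "norm (f m n) \<le> g m * h n" for m n
    using mult_left_mono[OF le_g[of m n], of "h n"] h(2)[of n]
    by (simp add: f_alt h_def norm_mult mult_ac)
  note D = double_series_dominated_by_product[OF g(1) h(1) bound g(2) h(2)]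
  have "(\<Sum>n. f m n) = outer_coeff q x m * even_series q (b * q ^ m)" for m
    unfolding f_def even_series_def e_def
    by (rule suminf_mult[OF summable_norm_cancel[OF summable_norm_even_series[OF q]]])
  moreover have "(\<Sum>m. f m n) = e b n * (\<Sum>m. outer_coeff q x m * q ^ (2 * n * m))" for n
    unfolding f_alt
    by (rule suminf_mult, rule summable_comparison_test'[OF g(1)]) (use le_g in auto)
  ultimately show ?thesis
    using D(1,2) by (simp add: sums_iff e_def)
qed

section \<open>Expansions in Ramanujan functions\<close>

text \<open>
The arguments of the Ramanujan functions contain \<open>q^(2 n - 1)\<close>, a negative power for \<open>n = 0\<close>. It
is always accompanied by a spare factor \<open>q\<close> from the quadratic exponent, which restores a
natural power.
\<close>
lemma mult_powi_double_minus_one: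
  fixes q :: complex
  assumes "q \<noteq> 0"
  shows "q * q powi (2 * int n - 1) = q ^ (2 * n)"
proof -
  have "q * q powi (2 * int n - 1) = q powi (1 + (2 * int n - 1))"
    using assms by (subst power_int_add) auto
  also have "\<dots> = q powi int (2 * n)"
    by simp
  finally show ?thesis
    by (simp only: power_int_of_nat)
qed

lemma ramanujan_A_eq_outer_sum:
  assumes "q \<noteq> 0"
  shows "ramanujan_A q (q powi (2 * int n - 1) * a * b)
      = (\<Sum>m. outer_coeff q (a * b) m * q ^ (2 * n * m))"
proof -
  have "q ^ m\<^sup>2 / qpoch q q m * (- (q powi (2 * int n - 1) * a * b)) ^ m
      = outer_coeff q (a * b) m * q ^ (2 * n * m)" for m
  proof -
    have "m\<^sup>2 = (m choose 2) + (m choose 2) + m"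
      by (induction m) (simp_all add: Suc_choose_two power2_eq_square)
    then have "q ^ m\<^sup>2 = q ^ (m choose 2) * q ^ (m choose 2) * q ^ m"
      by (simp add: power_add)
    moreover have "q ^ m * (- (q powi (2 * int n - 1) * a * b)) ^ m
        = (- (a * b)) ^ m * q ^ (2 * n * m)"
    proof -
      have "q * - (q powi (2 * int n - 1) * a * b) = - (a * b) * q ^ (2 * n)"
        by (simp add: mult_powi_double_minus_one[OF assms, symmetric])
      then show ?thesis
        by (metis power_mult_distrib power_mult)
    qed
    ultimately show ?thesis
      by (simp add: outer_coeff_def euler_coeff_def mult_ac)
  qed
  then show ?thesis
    by (simp add: ramanujan_A_def)
qed

lemma ramanujan_A_square_eq_even_series:
  assumes "q \<noteq> 0"
  shows "ramanujan_A (q\<^sup>2) (- (q powi (2 * int m - 1) * b\<^sup>2)) = even_series q (b * q ^ m)"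
proof -
  have "(q\<^sup>2) ^ n\<^sup>2 / qpoch (q\<^sup>2) (q\<^sup>2) n * (- (- (q powi (2 * int m - 1) * b\<^sup>2))) ^ n
      = q ^ ((2 * n) choose 2) * (b * q ^ m) ^ (2 * n) / qpoch (q\<^sup>2) (q\<^sup>2) n" for n
  proof -
    have "2 * n\<^sup>2 = ((2 * n) choose 2) + n"
      unfolding double_choose_two by (cases n) (simp_all add: power2_eq_square)
    then have "(q\<^sup>2) ^ n\<^sup>2 = q ^ ((2 * n) choose 2) * q ^ n"
      by (metis power_add power_mult)
    moreover have "q ^ n * (q powi (2 * int m - 1) * b\<^sup>2) ^ n = (b * q ^ m) ^ (2 * n)"
    proof -
      have "q * (q powi (2 * int m - 1) * b\<^sup>2) = (b * q ^ m)\<^sup>2"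
        using mult_powi_double_minus_one[OF assms, of m]
        by (simp add: power_mult_distrib power_mult[symmetric] mult_ac)
      then show ?thesis
        by (metis power_mult_distrib power_mult)
    qed
    ultimately show ?thesis
      by (simp add: mult_ac)
  qed
  then show ?thesis
    by (simp only: ramanujan_A_def even_series_def)
qed

lemma qpoch_nonzero:
  assumes "q \<noteq> 0" and "z \<notin> {q powi n | n :: int. n \<le> 0}"
  shows "qpoch z q n \<noteq> 0"
proof
  assume "qpoch z q n = 0"
  then obtain k where "z * q ^ k = 1"
    by (auto simp: qpoch_def)
  then have "z = q powi (- int k)"
    using assms(1) by (simp add: power_int_minus field_simps)
  with assms(2) show False
    by auto
qed

theorem theorem1p2:
  fixes q :: complex
  assumes "0 < norm q" and "norm q < 1"
  shows "(\<forall>a z :: complex. z \<notin> {q powi n | n :: int. n \<le> 0} \<longrightarrow>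
            qpoch_inf z q * phi11 a z q (- z) =
              (\<Sum>n. q ^ (2 * n\<^sup>2 - n) * z ^ (2 * n) / qpoch (q\<^sup>2) (q\<^sup>2) n
                    * ramanujan_A q (q powi (2 * int n - 1) * a * z)))
       \<and> (\<forall>a b :: complex. b \<notin> {q powi n | n :: int. n \<le> 0} \<longrightarrow>
            qpoch_inf b q * phi11 a b q (- b) =
              (\<Sum>n. q ^ (n\<^sup>2 - n) * (- (a * b)) ^ n / qpoch q q n
                    * ramanujan_A (q\<^sup>2) (- (q powi (2 * int n - 1) * b\<^sup>2))))
       \<and> (\<forall>a b :: complex.
              (\<Sum>n. q ^ (2 * n\<^sup>2 - n) * b ^ (2 * n) / qpoch (q\<^sup>2) (q\<^sup>2) n
                    * ramanujan_A q (q powi (2 * int n - 1) * a * b))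
            = (\<Sum>n. q ^ (n\<^sup>2 - n) * (- (a * b)) ^ n / qpoch q q n
                    * ramanujan_A (q\<^sup>2) (- (q powi (2 * int n - 1) * b\<^sup>2))))"
proof -
  have q0: "q \<noteq> 0" and q: "norm q < 1"
    using assms by auto
  let ?L = "\<lambda>a b. \<Sum>m. outer_coeff q (a * b) m * even_series q (b * q ^ m)"
  have outer: "q ^ (n\<^sup>2 - n) * (- (a * b)) ^ n / qpoch q q n = outer_coeff q (a * b) n" for a b n
    by (simp add: outer_coeff_def euler_coeff_def square_minus_self mult_2 power_add mult_ac)
  have A: "(\<Sum>n. q ^ (2 * n\<^sup>2 - n) * b ^ (2 * n) / qpoch (q\<^sup>2) (q\<^sup>2) n
        * ramanujan_A q (q powi (2 * int n - 1) * a * b)) = ?L a b" for a b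
    by (simp only: swap_outer_coeff_even_series[OF q] ramanujan_A_eq_outer_sum[OF q0]
        double_choose_two)
  have B: "(\<Sum>n. q ^ (n\<^sup>2 - n) * (- (a * b)) ^ n / qpoch q q n
        * ramanujan_A (q\<^sup>2) (- (q powi (2 * int n - 1) * b\<^sup>2))) = ?L a b" for a b
    by (simp only: outer ramanujan_A_square_eq_even_series[OF q0])
  show ?thesis
    unfolding A B using qpoch_inf_mult_phi11[OF q qpoch_nonzero[OF q0]] by blast
qed

end
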